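(* For any strongly dense selection frame $(W,\{R_A\}_{A\subseteq W})$, the operation $\to_R$ on $\wp(W)$ defined by $$A\to_R B:=\{w\in W\mid \text{for all } v\in W,\ wR_Av\Rightarrow v\in B\}$$ is a preconditional on the Boolean algebra $\wp(W)$.
   Context: A preconditional on a bounded lattice $L$ is a binary operation $\to$ on $L$ such that for all $a,b,c\in L$: (1) $1\to a\leq a$; (2) $a\wedge b\leq a\to b$; (3) $a\to b\leq a\to(a\wedge b)$; (4) $a\to(b\wedge c)\leq a\to b$; (5) $a\to((a\wedge b)\to c)\leq (a\wedge b)\to c$. A selection frame is a pair $(W,\{R_A\}_{A\subseteq W})$ where $W$ is a nonempty set and each $R_A$ is a binary relation on $W$ such that for all $w,v\in W$ and $A\subseteq W$: (success) if $wR_Av$, then $v\in A$; (centering) if $w\in A$, then $wR_Av$ iff $v=w$. It is strongly dense if for all $w,v\in W$ and $A,B\subseteq W$: if $wR_{A\cap B}v$, then there is $u\in W$ with $wR_Au$ and $uR_{A\cap B}v$. *)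

theory Defs
  imports "HOL-Algebra.Complete_Lattice"
begin

locale preconditional = bounded_lattice L
  for L (structure) and imp (infixr \<open>\<^bold>\<rightarrow>\<close> 60) +
  assumes imp_closed:
      "\<lbrakk>a \<in> carrier L; b \<in> carrier L\<rbrakk> \<Longrightarrow> a \<^bold>\<rightarrow> b \<in> carrier L"
    and top_imp_le:
      "a \<in> carrier L \<Longrightarrow> (\<top> \<^bold>\<rightarrow> a) \<sqsubseteq> a"
    and meet_le_imp:
      "\<lbrakk>a \<in> carrier L; b \<in> carrier L\<rbrakk> \<Longrightarrow> (a \<sqinter> b) \<sqsubseteq> (a \<^bold>\<rightarrow> b)"
    and imp_le_imp_meet:
      "\<lbrakk>a \<in> carrier L; b \<in> carrier L\<rbrakk> \<Longrightarrow> (a \<^bold>\<rightarrow> b) \<sqsubseteq> (a \<^bold>\<rightarrow> (a \<sqinter> b))"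
    and imp_meet_le_imp:
      "\<lbrakk>a \<in> carrier L; b \<in> carrier L; c \<in> carrier L\<rbrakk>
        \<Longrightarrow> (a \<^bold>\<rightarrow> (b \<sqinter> c)) \<sqsubseteq> (a \<^bold>\<rightarrow> b)"
    and imp_meet_imp_le:
      "\<lbrakk>a \<in> carrier L; b \<in> carrier L; c \<in> carrier L\<rbrakk>
        \<Longrightarrow> (a \<^bold>\<rightarrow> ((a \<sqinter> b) \<^bold>\<rightarrow> c)) \<sqsubseteq> ((a \<sqinter> b) \<^bold>\<rightarrow> c)"

text \<open>The family \<open>R\<close> is a total HOL function; only its values at subsets of \<open>W\<close>
  are constrained and used.\<close>

locale selection_frame =
  fixes W :: "'w set" and R :: "'w set \<Rightarrow> 'w rel"
  assumes nonempty: "W \<noteq> {}"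
    and rel_on: "A \<subseteq> W \<Longrightarrow> R A \<subseteq> W \<times> W"
    and success:
      "\<lbrakk>A \<subseteq> W; w \<in> W; v \<in> W; (w, v) \<in> R A\<rbrakk> \<Longrightarrow> v \<in> A"
    and centering:
      "\<lbrakk>A \<subseteq> W; w \<in> W; v \<in> W; w \<in> A\<rbrakk> \<Longrightarrow> (w, v) \<in> R A \<longleftrightarrow> v = w"

locale strongly_dense_selection_frame = selection_frame +
  assumes strongly_dense:
    "\<lbrakk>A \<subseteq> W; B \<subseteq> W; w \<in> W; v \<in> W; (w, v) \<in> R (A \<inter> B)\<rbrakk>
      \<Longrightarrow> \<exists>u\<in>W. (w, u) \<in> R A \<and> (u, v) \<in> R (A \<inter> B)"

definition selection_imp ::
    "'w set \<Rightarrow> ('w set \<Rightarrow> 'w rel) \<Rightarrow> 'w set \<Rightarrow> 'w set \<Rightarrow> 'w set" where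
  "selection_imp W R A B = {w \<in> W. \<forall>v\<in>W. (w, v) \<in> R A \<longrightarrow> v \<in> B}"

definition powerset_algebra :: "'w set \<Rightarrow> 'w set gorder" where
  "powerset_algebra W = \<lparr>carrier = Pow W, eq = (=), le = (\<subseteq>)\<rparr>"

text \<open>The lattice operations of an ordered structure are derived from its order; on
  the powerset they are the set operations.\<close>

lemma powerset_algebra_simps [simp]:
  "carrier (powerset_algebra W) = Pow W"
  "x .=\<^bsub>powerset_algebra W\<^esub> y \<longleftrightarrow> x = y"
  "x \<sqsubseteq>\<^bsub>powerset_algebra W\<^esub> y \<longleftrightarrow> x \<subseteq> y"
  by (simp_all add: powerset_algebra_def)

lemma complete_lattice_powerset_algebra: "complete_lattice (powerset_algebra W)"
  unfolding powerset_algebra_def by (rule powerset_is_complete_lattice)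

lemma powerset_algebra_top: "\<top>\<^bsub>powerset_algebra W\<^esub> = W"
  unfolding Order.top_def by (rule some_equality) (auto simp: greatest_def)

lemma powerset_algebra_bottom: "\<bottom>\<^bsub>powerset_algebra W\<^esub> = {}"
  unfolding Order.bottom_def by (rule some_equality) (auto simp: least_def)

lemma powerset_algebra_meet:
  assumes "A \<subseteq> W" "B \<subseteq> W"
  shows "A \<sqinter>\<^bsub>powerset_algebra W\<^esub> B = A \<inter> B"
proof -
  have g: "greatest (powerset_algebra W) (A \<inter> B) (Lower (powerset_algebra W) {A, B})"
    using assms by (auto simp: greatest_def Lower_def)
  have "x = A \<inter> B" if "greatest (powerset_algebra W) x (Lower (powerset_algebra W) {A, B})" for x
    using g that by (auto simp: greatest_def)
  with g show ?thesis
    unfolding Lattice.meet_def Lattice.inf_def by (rule some_equality)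
qed

lemma powerset_algebra_join:
  assumes "A \<subseteq> W" "B \<subseteq> W"
  shows "A \<squnion>\<^bsub>powerset_algebra W\<^esub> B = A \<union> B"
proof -
  have l: "least (powerset_algebra W) (A \<union> B) (Upper (powerset_algebra W) {A, B})"
    using assms by (auto simp: least_def Upper_def)
  have "x = A \<union> B" if "least (powerset_algebra W) x (Upper (powerset_algebra W) {A, B})" for x
    using l that by (auto simp: least_def)
  with l show ?thesis
    unfolding Lattice.join_def Lattice.sup_def by (rule some_equality)
qed

end

theory Submission
  imports Defs
begin

text \<open>Each law of a preconditional reflects a frame condition. Centering makes every point of
  \<open>A\<close> see exactly itself along \<open>R A\<close>, which gives laws (1), with
  \<open>A = W\<close>, and (2). Success gives (3), law (4) is monotonicity in the consequent, and
  strong density gives (5) in \<open>selection_imp_absorb\<close>.\<close>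

context selection_frame
begin

lemma selection_imp_subset: "selection_imp W R A B \<subseteq> W"
  by (auto simp: selection_imp_def)

lemma selection_imp_mono: "B \<subseteq> C \<Longrightarrow> selection_imp W R A B \<subseteq> selection_imp W R A C"
  by (auto simp: selection_imp_def)

lemma selection_imp_top_subset: "selection_imp W R W A \<subseteq> A"
  using centering[of W] by (auto simp: selection_imp_def)

lemma Int_subset_selection_imp:
  "A \<subseteq> W \<Longrightarrow> A \<inter> B \<subseteq> selection_imp W R A B"
  using centering[of A] by (auto simp: selection_imp_def)

text \<open>By success all \<open>R A\<close>-successors already lie in \<open>A\<close>.\<close>

lemma selection_imp_Int: "A \<subseteq> W \<Longrightarrow> selection_imp W R A (A \<inter> B) = selection_imp W R A B"
  using success[of A] by (auto simp: selection_imp_def)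

end

text \<open>Density factors a step from \<open>w\<close> to \<open>v\<close> along
  \<open>R (A \<inter> B)\<close> through an \<open>R A\<close>-successor \<open>u\<close> of
  \<open>w\<close>; the inner conditional holds at \<open>u\<close>, so \<open>v\<close> is in
  \<open>C\<close>.\<close>

lemma (in strongly_dense_selection_frame) selection_imp_absorb:
  assumes "A \<subseteq> W" "B \<subseteq> W"
  shows "selection_imp W R A (selection_imp W R (A \<inter> B) C) \<subseteq> selection_imp W R (A \<inter> B) C"
  using strongly_dense[OF assms] unfolding selection_imp_def by blast

theorem proposition6:
  fixes W :: "'w set" and R :: "'w set \<Rightarrow> 'w rel"
  assumes "strongly_dense_selection_frame W R"
  shows "preconditional (powerset_algebra W) (selection_imp W R)"
proof -
  interpret strongly_dense_selection_frame W R by (rule assms)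
  \<comment> \<open>This supplies the bounded lattice axioms, so that closure and the five laws
    remain.\<close>
  interpret complete_lattice "powerset_algebra W"
    by (rule complete_lattice_powerset_algebra)
  show ?thesis
  proof unfold_locales
    fix A B C
    assume "A \<in> carrier (powerset_algebra W)" "B \<in> carrier (powerset_algebra W)"
      and C: "C \<in> carrier (powerset_algebra W)"
    then have AB: "A \<subseteq> W" "B \<subseteq> W" by simp_all
    then show "selection_imp W R A (selection_imp W R (A \<sqinter>\<^bsub>powerset_algebra W\<^esub> B) C)
        \<sqsubseteq>\<^bsub>powerset_algebra W\<^esub> selection_imp W R (A \<sqinter>\<^bsub>powerset_algebra W\<^esub> B) C"
      by (simp add: powerset_algebra_meet selection_imp_absorb)
    show "selection_imp W R A (B \<sqinter>\<^bsub>powerset_algebra W\<^esub> C)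
        \<sqsubseteq>\<^bsub>powerset_algebra W\<^esub> selection_imp W R A B"
      using AB C by (simp add: powerset_algebra_meet selection_imp_mono)
  qed (simp_all add: powerset_algebra_top powerset_algebra_meet selection_imp_subset
      selection_imp_top_subset Int_subset_selection_imp selection_imp_Int)
qed

end
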